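(* Let $(q_j)_{j\ge 1}$ be a sequence of odd prime powers with $q_j\to\infty$, and for each $j$ let a coloring of $\mathbb F_{q_j}^2$ be given. Suppose that for every constant $c>0$ (independent of $j$) there is $j_0(c)$ such that for all $j\ge j_0(c)$ no color class of the coloring of $\mathbb F_{q_j}^2$ has more than $c\,q_j^2$ elements. Then there exists $J$ such that for every $j\ge J$: if $\mathbb F_{q_j}^2$ contains a unit equilateral triangle, then $\mathbb F_{q_j}^2$ contains a rainbow unit equilateral triangle.
   Context: $\mathbb F_q$ denotes the finite field with $q$ elements. For $x=(x_1,x_2),y=(y_1,y_2)\in\mathbb F_q^2$ the "distance" is $d(x,y)=(x_1-y_1)^2+(x_2-y_2)^2\in\mathbb F_q$. A unit equilateral triangle in $\mathbb F_q^2$ is a set of three points $x,y,z\in\mathbb F_q^2$ with $d(x,y)=d(y,z)=d(x,z)=1$. A coloring of a set is a partition of it into disjoint nonempty subsets called color classes. A unit equilateral triangle is rainbow if its three vertices lie in three distinct color classes. *)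

theory Defs
  imports
    Complex_Main
    "HOL-Library.Disjoint_Sets"
    "HOL-Number_Theory.Prime_Powers"
    "HOL-Algebra.Ring"
    "HOL-Algebra.Coset"
begin

definition plane :: "('a, 'm) ring_scheme \<Rightarrow> ('a \<times> 'a) set" where
  "plane F = carrier F \<times> carrier F"

definition sq_dist :: "('a, 'm) ring_scheme \<Rightarrow> 'a \<times> 'a \<Rightarrow> 'a \<times> 'a \<Rightarrow> 'a" where
  "sq_dist F x y =
     ((fst x \<ominus>\<^bsub>F\<^esub> fst y) [^]\<^bsub>F\<^esub> (2::nat)) \<oplus>\<^bsub>F\<^esub> ((snd x \<ominus>\<^bsub>F\<^esub> snd y) [^]\<^bsub>F\<^esub> (2::nat))"

(* The three vertices are automatically distinct, since sq_dist F x x is zero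
   and differs from one in a field. *)
definition unit_equilateral_triangle :: "('a, 'm) ring_scheme \<Rightarrow> ('a \<times> 'a) set \<Rightarrow> bool" where
  "unit_equilateral_triangle F T \<longleftrightarrow>
     (\<exists>x y z. x \<in> plane F \<and> y \<in> plane F \<and> z \<in> plane F \<and> T = {x, y, z} \<and>
        sq_dist F x y = \<one>\<^bsub>F\<^esub> \<and> sq_dist F y z = \<one>\<^bsub>F\<^esub> \<and> sq_dist F x z = \<one>\<^bsub>F\<^esub>)"

definition rainbow_triangle :: "'p set set \<Rightarrow> 'p set \<Rightarrow> bool" where
  "rainbow_triangle P T \<longleftrightarrow>
     (\<exists>x y z A B C. T = {x, y, z} \<and> A \<in> P \<and> B \<in> P \<and> C \<in> P \<and> distinct [A, B, C] \<and>
        x \<in> A \<and> y \<in> B \<and> z \<in> C)"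

end

theory Submission
  imports Defs "HOL-Analysis.Convex" "HOL-Algebra.Multiplicative_Group"
begin

text \<open>
  Join two points of the plane over the field with \<open>q\<close> elements when their distance is \<open>1\<close>. In odd
  characteristic two distinct unit circles meet in at most two points, so any two distinct vertices
  of this graph have at most two common neighbours. By Cauchy-Schwarz (as in the theorem of Kovari,
  Sos and Turan), a colour class \<open>A\<close> then spans at most \<open>|A| sqrt(D + 2|A|)\<close> ordered edges, where
  \<open>D\<close> bounds the degrees. Summing over the classes, if each has at most \<open>K\<close> elements, at most
  \<open>q\<^sup>2 sqrt(D + 2K)\<close> ordered edges have both ends of the same colour.

  Suppose that there is a unit equilateral triangle. A rotated copy of it stands on every unit edge.
  If no triangle is rainbow, every edge is therefore monochromatic or shares a triangle with a
  monochromatic edge. A given edge lies in at most two triangles, so at least one fifth of all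
  ordered edges are monochromatic. A unit circle has at least \<open>q - 2\<close> and at most \<open>2q\<close> points, hence
  \<open>q - 2 \<le> 5 sqrt(2q + 2K)\<close>. For \<open>K = q\<^sup>2/200\<close> the right-hand side grows like \<open>q/2\<close>, which is
  impossible for large \<open>q\<close>.

  The counting is carried by \<open>card_mono_edges_le\<close> and \<open>card_edges_le_mono_edges\<close>, the geometry by
  \<open>two_circles\<close>, \<open>third_vertex\<close> and the two bounds on the unit circle.
\<close>

section \<open>Monochromatic edges in graphs with few common neighbours\<close>

text \<open>
  A finite simple graph on \<open>V\<close> with degrees at most \<open>D\<close> in which distinct vertices have at most two
  common neighbours. The relation \<open>adj\<close> is only constrained on \<open>V\<close>.
\<close>
locale small_codegree_graph =
  fixes V :: "'v set" and adj :: "'v \<Rightarrow> 'v \<Rightarrow> bool" and D :: real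
  assumes finite_V: "finite V"
    and adj_sym: "\<And>x y. x \<in> V \<Longrightarrow> y \<in> V \<Longrightarrow> adj x y \<Longrightarrow> adj y x"
    and adj_irrefl: "\<And>x. x \<in> V \<Longrightarrow> \<not> adj x x"
    and degree_le: "\<And>x. x \<in> V \<Longrightarrow> real (card {w \<in> V. adj x w}) \<le> D"
    and codegree_le: "\<And>x y. x \<in> V \<Longrightarrow> y \<in> V \<Longrightarrow> x \<noteq> y \<Longrightarrow>
      card {w \<in> V. adj x w \<and> adj y w} \<le> 2"
begin

text \<open>Edges are ordered pairs, so each undirected edge counts twice.\<close>
definition edges :: "('v \<times> 'v) set" where
  "edges = {(x, y). x \<in> V \<and> y \<in> V \<and> adj x y}"

text \<open>The ordered edges with both ends in a common class of \<open>P\<close>.\<close>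
definition mono_edges :: "'v set set \<Rightarrow> ('v \<times> 'v) set" where
  "mono_edges P = {(x, y) \<in> edges. \<exists>A\<in>P. x \<in> A \<and> y \<in> A}"

text \<open>Both sides count the triples \<open>(x, y, z)\<close> with \<open>y, z\<close> in \<open>A\<close> and \<open>x\<close> adjacent to both.\<close>
lemma sum_card_nbhd_Int_sq:
  assumes "A \<subseteq> V"
  shows "(\<Sum>x\<in>V. (real (card {y \<in> A. adj x y}))\<^sup>2) =
    (\<Sum>y\<in>A. \<Sum>z\<in>A. real (card {x \<in> V. adj y x \<and> adj z x}))"
proof -
  have fin: "finite A" using assms finite_V finite_subset by blast
  have "(\<Sum>x\<in>V. (real (card {y \<in> A. adj x y}))\<^sup>2) =
      (\<Sum>x\<in>V. \<Sum>y\<in>A. \<Sum>z\<in>A. of_bool (adj x y \<and> adj x z))"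
  proof (intro sum.cong refl)
    fix x
    have "real (card {y \<in> A. adj x y}) = (\<Sum>y\<in>A. of_bool (adj x y))"
      using fin by (simp add: sum_of_bool_eq Int_def)
    then show "(real (card {y \<in> A. adj x y}))\<^sup>2 = (\<Sum>y\<in>A. \<Sum>z\<in>A. of_bool (adj x y \<and> adj x z))"
      by (simp only: power2_eq_square sum_product of_bool_conj)
  qed
  also have "\<dots> = (\<Sum>y\<in>A. \<Sum>z\<in>A. \<Sum>x\<in>V. of_bool (adj x y \<and> adj x z))"
    by (subst sum.swap, intro sum.cong refl sum.swap)
  also have "\<dots> = (\<Sum>y\<in>A. \<Sum>z\<in>A. real (card {x \<in> V. adj y x \<and> adj z x}))"
  proof (intro sum.cong refl)
    fix y z assume "y \<in> A" "z \<in> A"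
    then have "{x \<in> V. adj y x \<and> adj z x} = V \<inter> {x. adj x y \<and> adj x z}"
      using assms adj_sym by blast
    then show "(\<Sum>x\<in>V. of_bool (adj x y \<and> adj x z)) = real (card {x \<in> V. adj y x \<and> adj z x})"
      using finite_V by (simp add: sum_of_bool_eq)
  qed
  finally show ?thesis .
qed

lemma inner_edges_le:
  assumes A: "A \<subseteq> V" and K: "real (card A) \<le> K"
  shows "(\<Sum>x\<in>A. real (card {y \<in> A. adj x y})) \<le> real (card A) * sqrt (D + 2 * K)"
proof -
  have fin: "finite A" using A finite_V finite_subset by blast
  have "(\<Sum>x\<in>A. real (card {y \<in> A. adj x y}))\<^sup>2
      \<le> (\<Sum>x\<in>A. (real (card {y \<in> A. adj x y}))\<^sup>2) * real (card A)"
    using sum_squared_le_sum_of_squares[of "\<lambda>x. real (card {y \<in> A. adj x y})" A] by simp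
  also have "(\<Sum>x\<in>A. (real (card {y \<in> A. adj x y}))\<^sup>2)
      \<le> (\<Sum>x\<in>V. (real (card {y \<in> A. adj x y}))\<^sup>2)"
    using A finite_V by (intro sum_mono2) auto
  also have "\<dots> = (\<Sum>y\<in>A. \<Sum>z\<in>A. real (card {x \<in> V. adj y x \<and> adj z x}))"
    by (rule sum_card_nbhd_Int_sq[OF A])
  also have "\<dots> \<le> (\<Sum>y\<in>A. \<Sum>z\<in>A. (if z = y then D else 0) + 2)"
  proof (intro sum_mono)
    fix y z assume "y \<in> A" "z \<in> A"
    then have yz: "y \<in> V" "z \<in> V" using A by auto
    show "real (card {x \<in> V. adj y x \<and> adj z x}) \<le> (if z = y then D else 0) + 2"
    proof (cases "z = y")
      case True
      then show ?thesis using degree_le[OF yz(1)] by simp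
    next
      case False
      then show ?thesis using codegree_le[OF yz] by simp
    qed
  qed
  also have "\<dots> = real (card A) * (D + 2 * real (card A))"
    using fin by (simp add: sum.distrib algebra_simps)
  also have "\<dots> \<le> real (card A) * (D + 2 * K)"
    using K by (intro mult_left_mono) auto
  finally have "(\<Sum>x\<in>A. real (card {y \<in> A. adj x y}))\<^sup>2
      \<le> (real (card A))\<^sup>2 * (D + 2 * K)"
    by (simp add: mult_right_mono power2_eq_square mult_ac)
  then have "(\<Sum>x\<in>A. real (card {y \<in> A. adj x y})) \<le> sqrt ((real (card A))\<^sup>2 * (D + 2 * K))"
    by (rule real_le_rsqrt)
  then show ?thesis by (simp add: real_sqrt_mult)
qed

lemma card_mono_edges_le:
  assumes P: "partition_on V P" and K: "\<And>A. A \<in> P \<Longrightarrow> real (card A) \<le> K"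
  shows "real (card (mono_edges P)) \<le> real (card V) * sqrt (D + 2 * K)"
proof -
  have finP: "finite P" using finite_elements[OF finite_V P] .
  have sub: "A \<subseteq> V" if "A \<in> P" for A using partition_onD1[OF P] that by blast
  have finA: "finite A" if "A \<in> P" for A using sub[OF that] finite_V finite_subset by blast
  have "mono_edges P \<subseteq> (\<Union>A\<in>P. SIGMA x:A. {y \<in> A. adj x y})"
    by (auto simp: mono_edges_def edges_def)
  then have "card (mono_edges P) \<le> card (\<Union>A\<in>P. SIGMA x:A. {y \<in> A. adj x y})"
    using finP finA by (intro card_mono) auto
  also have "\<dots> \<le> (\<Sum>A\<in>P. card (SIGMA x:A. {y \<in> A. adj x y}))"
    by (rule card_UN_le[OF finP])
  also have "\<dots> = (\<Sum>A\<in>P. \<Sum>x\<in>A. card {y \<in> A. adj x y})"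
    using finA by (intro sum.cong refl card_SigmaI) auto
  finally have "real (card (mono_edges P)) \<le> (\<Sum>A\<in>P. \<Sum>x\<in>A. real (card {y \<in> A. adj x y}))"
    by (simp flip: of_nat_sum)
  also have "\<dots> \<le> (\<Sum>A\<in>P. real (card A) * sqrt (D + 2 * K))"
    using inner_edges_le sub K by (intro sum_mono) blast
  also have "\<dots> = real (card V) * sqrt (D + 2 * K)"
    using product_partition[OF P finA] by (simp add: sum_distrib_right)
  finally show ?thesis .
qed

text \<open>
  If every edge lies in a triangle and every triangle has a monochromatic side, then an edge is
  monochromatic or completes a monochromatic edge \<open>(x, z)\<close> or \<open>(y, z)\<close> to a triangle. Each
  monochromatic edge arises at most twice in each of the two latter ways, whence \<open>5 = 1 + 2 + 2\<close>.
\<close>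
lemma card_edges_le_mono_edges:
  assumes tri: "\<And>x y. (x, y) \<in> edges \<Longrightarrow> \<exists>z\<in>V. adj x z \<and> adj y z"
    and rainbow_free: "\<And>x y z. x \<in> V \<Longrightarrow> y \<in> V \<Longrightarrow> z \<in> V \<Longrightarrow> adj x y \<Longrightarrow> adj x z \<Longrightarrow> adj y z \<Longrightarrow>
      \<exists>A\<in>P. x \<in> A \<and> y \<in> A \<or> x \<in> A \<and> z \<in> A \<or> y \<in> A \<and> z \<in> A"
  shows "card edges \<le> 5 * card (mono_edges P)"
proof -
  define M where "M = mono_edges P"
  define common where "common x y = {w \<in> V. adj x w \<and> adj y w}" for x y
  have "edges \<subseteq> V \<times> V" by (auto simp: edges_def)
  then have finM: "finite M"
    using finite_V by (auto simp: M_def mono_edges_def intro: finite_subset[of _ "V \<times> V"])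
  have fin_common: "finite (common x y)" for x y
    using finite_V by (simp add: common_def)
  have cod: "card (common x y) \<le> 2" if "(x, y) \<in> M" for x y
    using that codegree_le adj_irrefl by (fastforce simp: M_def mono_edges_def edges_def common_def)
  let ?F = "\<lambda>(x, z). Pair x ` common x z" and ?G = "\<lambda>(y, z). (\<lambda>x. (x, y)) ` common y z"
  have "edges \<subseteq> M \<union> (\<Union>e\<in>M. ?F e) \<union> (\<Union>e\<in>M. ?G e)"
  proof
    fix e assume "e \<in> edges"
    then obtain x y where e: "e = (x, y)" "x \<in> V" "y \<in> V" "adj x y"
      by (auto simp: edges_def)
    then obtain z where z: "z \<in> V" "adj x z" "adj y z" using tri by (auto simp: edges_def)
    have "(x, y) \<in> M \<or> (x, z) \<in> M \<or> (y, z) \<in> M"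
      using rainbow_free[OF e(2,3) z(1) e(4) z(2,3)] e z by (auto simp: M_def mono_edges_def edges_def)
    moreover have "y \<in> common x z" "x \<in> common y z"
      using e z adj_sym by (auto simp: common_def)
    ultimately show "e \<in> M \<union> (\<Union>e\<in>M. ?F e) \<union> (\<Union>e\<in>M. ?G e)"
      unfolding e(1) by fast
  qed
  then have "card edges \<le> card (M \<union> (\<Union>e\<in>M. ?F e) \<union> (\<Union>e\<in>M. ?G e))"
    using finM fin_common by (intro card_mono) auto
  also have "\<dots> \<le> card M + card (\<Union>e\<in>M. ?F e) + card (\<Union>e\<in>M. ?G e)"
    by (meson add_mono_thms_linordered_semiring(3) card_Un_le order_trans)
  also have "card (\<Union>e\<in>M. ?F e) \<le> (\<Sum>e\<in>M. 2)"
    using cod by (intro order.trans[OF card_UN_le[OF finM]] sum_mono)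
      (auto intro!: order.trans[OF card_image_le] fin_common)
  also have "card (\<Union>e\<in>M. ?G e) \<le> (\<Sum>e\<in>M. 2)"
    using cod by (intro order.trans[OF card_UN_le[OF finM]] sum_mono)
      (auto intro!: order.trans[OF card_image_le] fin_common)
  finally show ?thesis by (simp add: M_def)
qed

end

section \<open>Plane geometry over a field of odd characteristic\<close>

context field
begin

abbreviation two ("\<two>") where "\<two> \<equiv> \<one> \<oplus> \<one>"

lemma two_nonzero_of_odd_order:
  assumes "odd (order R)"
  shows "\<two> \<noteq> \<zero>"
proof
  assume "\<two> = \<zero>"
  then have "\<one> [^]\<^bsub>add_monoid R\<^esub> (2::nat) = \<one>\<^bsub>add_monoid R\<^esub>"
    by (simp add: numeral_2_eq_2)
  then have "group.ord (add_monoid R) \<one> dvd 2"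
    using group.pow_eq_id[OF a_group, of \<one> 2] by simp
  moreover have "group.ord (add_monoid R) \<one> dvd order R"
    using group.ord_dvd_group_order[OF a_group, of \<one>] by (simp add: order_def)
  moreover have "group.ord (add_monoid R) \<one> \<noteq> 1"
    using group.ord_eq_1[OF a_group, of \<one>] by simp
  ultimately show False
    using assms by (metis dvd_trans prime_nat_iff two_is_prime_nat)
qed

text \<open>In the plane, two vectors orthogonal to the same nonzero vector are parallel.\<close>
lemma orthogonal_to_same_imp_parallel:
  assumes "p1 \<in> carrier R" "p2 \<in> carrier R" "q1 \<in> carrier R" "q2 \<in> carrier R"
    and "b1 \<in> carrier R" "b2 \<in> carrier R"
    and pb: "p1 \<otimes> b1 \<oplus> p2 \<otimes> b2 = \<zero>" and qb: "q1 \<otimes> b1 \<oplus> q2 \<otimes> b2 = \<zero>"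
    and "b1 \<noteq> \<zero> \<or> b2 \<noteq> \<zero>"
  shows "p1 \<otimes> q2 \<ominus> p2 \<otimes> q1 = \<zero>"
proof -
  have "(p1 \<otimes> q2 \<ominus> p2 \<otimes> q1) \<otimes> b1 = q2 \<otimes> (p1 \<otimes> b1 \<oplus> p2 \<otimes> b2) \<ominus> p2 \<otimes> (q1 \<otimes> b1 \<oplus> q2 \<otimes> b2)"
    using assms(1-6) by algebra
  then have "(p1 \<otimes> q2 \<ominus> p2 \<otimes> q1) \<otimes> b1 = \<zero>"
    using assms(1-6) by (simp add: pb qb)
  moreover have "(p1 \<otimes> q2 \<ominus> p2 \<otimes> q1) \<otimes> b2 = p1 \<otimes> (q1 \<otimes> b1 \<oplus> q2 \<otimes> b2) \<ominus> q1 \<otimes> (p1 \<otimes> b1 \<oplus> p2 \<otimes> b2)"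
    using assms(1-6) by algebra
  then have "(p1 \<otimes> q2 \<ominus> p2 \<otimes> q1) \<otimes> b2 = \<zero>"
    using assms(1-6) by (simp add: pb qb)
  ultimately show ?thesis
    using assms by (meson integral minus_closed m_closed)
qed

text \<open>A vector both orthogonal and parallel to a non-isotropic vector vanishes.\<close>
lemma orthogonal_and_parallel_imp_zero:
  assumes "v1 \<in> carrier R" "v2 \<in> carrier R" "a1 \<in> carrier R" "a2 \<in> carrier R"
    and dot: "v1 \<otimes> a1 \<oplus> v2 \<otimes> a2 = \<zero>" and cross: "v1 \<otimes> a2 \<ominus> v2 \<otimes> a1 = \<zero>"
    and "v1 \<otimes> v1 \<oplus> v2 \<otimes> v2 \<noteq> \<zero>"
  shows "a1 = \<zero> \<and> a2 = \<zero>"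
proof -
  have "(v1 \<otimes> v1 \<oplus> v2 \<otimes> v2) \<otimes> a1 =
      v1 \<otimes> (v1 \<otimes> a1 \<oplus> v2 \<otimes> a2) \<ominus> v2 \<otimes> (v1 \<otimes> a2 \<ominus> v2 \<otimes> a1)"
    using assms(1-4) by algebra
  then have "(v1 \<otimes> v1 \<oplus> v2 \<otimes> v2) \<otimes> a1 = \<zero>"
    using assms(1-4) by (simp add: dot cross)
  moreover have "(v1 \<otimes> v1 \<oplus> v2 \<otimes> v2) \<otimes> a2 =
      v2 \<otimes> (v1 \<otimes> a1 \<oplus> v2 \<otimes> a2) \<oplus> v1 \<otimes> (v1 \<otimes> a2 \<ominus> v2 \<otimes> a1)"
    using assms(1-4) by algebra
  then have "(v1 \<otimes> v1 \<oplus> v2 \<otimes> v2) \<otimes> a2 = \<zero>"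
    using assms(1-4) by (simp add: dot cross)
  ultimately show ?thesis
    using assms by (meson integral a_closed m_closed)
qed

text \<open>
  If \<open>u\<close> lies on the unit circles around \<open>0\<close> and around \<open>v \<noteq> 0\<close>, then the only other common
  point can be \<open>v - u\<close>. For a common point \<open>w\<close> the vectors \<open>v\<close>, \<open>a = w - u\<close> and \<open>b = w - (v - u)\<close>
  turn out to be pairwise orthogonal, and in the plane this forces \<open>a = 0\<close> or \<open>b = 0\<close> because \<open>v\<close> is
  not isotropic.
\<close>
lemma two_circles:
  assumes two: "\<two> \<noteq> \<zero>"
    and C: "u1 \<in> carrier R" "u2 \<in> carrier R" "w1 \<in> carrier R" "w2 \<in> carrier R"
      "v1 \<in> carrier R" "v2 \<in> carrier R"
    and u: "u1 \<otimes> u1 \<oplus> u2 \<otimes> u2 = \<one>" and w: "w1 \<otimes> w1 \<oplus> w2 \<otimes> w2 = \<one>"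
    and uv: "(u1 \<ominus> v1) \<otimes> (u1 \<ominus> v1) \<oplus> (u2 \<ominus> v2) \<otimes> (u2 \<ominus> v2) = \<one>"
    and wv: "(w1 \<ominus> v1) \<otimes> (w1 \<ominus> v1) \<oplus> (w2 \<ominus> v2) \<otimes> (w2 \<ominus> v2) = \<one>"
    and v: "v1 \<noteq> \<zero> \<or> v2 \<noteq> \<zero>"
  shows "w1 = u1 \<and> w2 = u2 \<or> w1 = v1 \<ominus> u1 \<and> w2 = v2 \<ominus> u2"
proof -
  define n where "n = v1 \<otimes> v1 \<oplus> v2 \<otimes> v2"
  define a1 where "a1 = w1 \<ominus> u1"
  define a2 where "a2 = w2 \<ominus> u2"
  define b1 where "b1 = w1 \<ominus> (v1 \<ominus> u1)"
  define b2 where "b2 = w2 \<ominus> (v2 \<ominus> u2)"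
  have nC: "n \<in> carrier R" using C by (simp add: n_def)
  have abC: "a1 \<in> carrier R" "a2 \<in> carrier R" "b1 \<in> carrier R" "b2 \<in> carrier R"
    using C by (simp_all add: a1_def a2_def b1_def b2_def)
  \<comment> \<open>Subtracting the equations of the two circles leaves the equation of their radical axis.\<close>
  have proj: "\<two> \<otimes> (x \<otimes> v1 \<oplus> y \<otimes> v2) = n"
    if "x \<in> carrier R" "y \<in> carrier R" "x \<otimes> x \<oplus> y \<otimes> y = \<one>"
      "(x \<ominus> v1) \<otimes> (x \<ominus> v1) \<oplus> (y \<ominus> v2) \<otimes> (y \<ominus> v2) = \<one>" for x y
  proof -
    have "\<two> \<otimes> (x \<otimes> v1 \<oplus> y \<otimes> v2) = (x \<otimes> x \<oplus> y \<otimes> y) \<oplus> n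
        \<ominus> ((x \<ominus> v1) \<otimes> (x \<ominus> v1) \<oplus> (y \<ominus> v2) \<otimes> (y \<ominus> v2))"
      unfolding n_def using that(1,2) C by algebra
    also have "\<dots> = n" unfolding that using nC by algebra
    finally show ?thesis .
  qed
  note pu = proj[OF C(1,2) u uv] and pw = proj[OF C(3,4) w wv]
  have half: "x = \<zero>" if "x \<in> carrier R" "\<two> \<otimes> x = \<zero>" for x
    using that two by (metis integral a_closed one_closed)
  have "\<two> \<otimes> (v1 \<otimes> a1 \<oplus> v2 \<otimes> a2) = \<two> \<otimes> (w1 \<otimes> v1 \<oplus> w2 \<otimes> v2) \<ominus> \<two> \<otimes> (u1 \<otimes> v1 \<oplus> u2 \<otimes> v2)"
    unfolding a1_def a2_def using C by algebra
  also have "\<dots> = \<zero>" unfolding pu pw using nC by algebra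
  finally have va: "v1 \<otimes> a1 \<oplus> v2 \<otimes> a2 = \<zero>" using half abC C by simp
  have "v1 \<otimes> b1 \<oplus> v2 \<otimes> b2 = (w1 \<otimes> v1 \<oplus> w2 \<otimes> v2) \<oplus> (u1 \<otimes> v1 \<oplus> u2 \<otimes> v2) \<ominus> n"
    unfolding b1_def b2_def n_def using C by algebra
  moreover have "\<two> \<otimes> (p \<oplus> q \<ominus> n) = \<two> \<otimes> p \<oplus> \<two> \<otimes> q \<ominus> \<two> \<otimes> n"
    if "p \<in> carrier R" "q \<in> carrier R" for p q
    using that nC by algebra
  ultimately have "\<two> \<otimes> (v1 \<otimes> b1 \<oplus> v2 \<otimes> b2) =
      \<two> \<otimes> (w1 \<otimes> v1 \<oplus> w2 \<otimes> v2) \<oplus> \<two> \<otimes> (u1 \<otimes> v1 \<oplus> u2 \<otimes> v2) \<ominus> \<two> \<otimes> n"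
    using C by simp
  also have "\<dots> = \<zero>" unfolding pu pw using nC by algebra
  finally have vb: "v1 \<otimes> b1 \<oplus> v2 \<otimes> b2 = \<zero>" using half abC C by simp
  have "a1 \<otimes> b1 \<oplus> a2 \<otimes> b2 = (w1 \<otimes> w1 \<oplus> w2 \<otimes> w2) \<ominus> (u1 \<otimes> u1 \<oplus> u2 \<otimes> u2) \<ominus> (v1 \<otimes> a1 \<oplus> v2 \<otimes> a2)"
    unfolding a1_def a2_def b1_def b2_def using C by algebra
  also have "\<dots> = \<zero>" unfolding u w va by algebra
  finally have ab: "a1 \<otimes> b1 \<oplus> a2 \<otimes> b2 = \<zero>" .
  \<comment> \<open>If \<open>v\<close> were isotropic, it would be orthogonal, hence also parallel, to the unit vector \<open>u\<close>.\<close>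
  have n0: "v1 \<otimes> v1 \<oplus> v2 \<otimes> v2 \<noteq> \<zero>"
  proof
    assume n0: "v1 \<otimes> v1 \<oplus> v2 \<otimes> v2 = \<zero>"
    then have uv0: "u1 \<otimes> v1 \<oplus> u2 \<otimes> v2 = \<zero>" using half pu C by (simp add: n_def)
    have "u1 \<otimes> v2 \<ominus> u2 \<otimes> v1 = \<zero>"
      using orthogonal_to_same_imp_parallel[OF C(1,2,5,6,5,6) uv0 n0 v] .
    then show False
      using orthogonal_and_parallel_imp_zero[OF C(1,2,5,6) uv0] v u by simp
  qed
  have "a1 = \<zero> \<and> a2 = \<zero> \<or> b1 = \<zero> \<and> b2 = \<zero>"
  proof (rule disjCI)
    assume "\<not> (b1 = \<zero> \<and> b2 = \<zero>)"
    then have "v1 \<otimes> a2 \<ominus> v2 \<otimes> a1 = \<zero>"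
      using orthogonal_to_same_imp_parallel[OF C(5,6) abC vb ab] by blast
    then show "a1 = \<zero> \<and> a2 = \<zero>"
      using orthogonal_and_parallel_imp_zero[OF C(5,6) abC(1,2) va _ n0] by blast
  qed
  then show ?thesis
    using C unfolding a1_def a2_def b1_def b2_def by (auto simp: r_right_minus_eq)
qed

text \<open>The norm \<open>a\<^sup>2 + b\<^sup>2\<close> is multiplicative for the product of complex numbers \<open>a + b i\<close>.\<close>
lemma brahmagupta:
  assumes "a \<in> carrier R" "b \<in> carrier R" "c \<in> carrier R" "d \<in> carrier R"
  shows "(a \<otimes> c \<ominus> b \<otimes> d) \<otimes> (a \<otimes> c \<ominus> b \<otimes> d) \<oplus> (a \<otimes> d \<oplus> b \<otimes> c) \<otimes> (a \<otimes> d \<oplus> b \<otimes> c) =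
    (a \<otimes> a \<oplus> b \<otimes> b) \<otimes> (c \<otimes> c \<oplus> d \<otimes> d)"
  using assms by algebra

text \<open>
  Let \<open>p\<close> and \<open>r\<close> be two sides of a unit equilateral triangle issuing from the same vertex. In complex
  notation, \<open>a + b i\<close> is the product of \<open>r\<close> with the conjugate of \<open>p\<close>. Multiplication by it is the
  rotation taking \<open>p\<close> to \<open>r\<close> (of angle 60 degrees over the reals; it is \<open>-1\<close> in characteristic 3,
  where such triangles are collinear).
\<close>
lemma rotation_by_sixty_degrees:
  assumes C: "p1 \<in> carrier R" "p2 \<in> carrier R" "r1 \<in> carrier R" "r2 \<in> carrier R"
    and p: "p1 \<otimes> p1 \<oplus> p2 \<otimes> p2 = \<one>" and r: "r1 \<otimes> r1 \<oplus> r2 \<otimes> r2 = \<one>"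
    and rp: "(r1 \<ominus> p1) \<otimes> (r1 \<ominus> p1) \<oplus> (r2 \<ominus> p2) \<otimes> (r2 \<ominus> p2) = \<one>"
  obtains a b where "a \<in> carrier R" "b \<in> carrier R" "a \<otimes> a \<oplus> b \<otimes> b = \<one>"
    "(\<one> \<ominus> a) \<otimes> (\<one> \<ominus> a) \<oplus> b \<otimes> b = \<one>"
proof
  let ?a = "r1 \<otimes> p1 \<oplus> r2 \<otimes> p2" and ?b = "r2 \<otimes> p1 \<ominus> r1 \<otimes> p2"
  show aC: "?a \<in> carrier R" and bC: "?b \<in> carrier R" using C by simp_all
  have "?a \<otimes> ?a \<oplus> ?b \<otimes> ?b = (r1 \<otimes> r1 \<oplus> r2 \<otimes> r2) \<otimes> (p1 \<otimes> p1 \<oplus> p2 \<otimes> p2)"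
    using brahmagupta[of r2 r1 p1 p2] C by (simp only: a_comm m_closed minus_closed a_closed)
  also have "\<dots> = \<one>" by (simp add: p r)
  finally show ab: "?a \<otimes> ?a \<oplus> ?b \<otimes> ?b = \<one>" .
  have "\<two> \<otimes> ?a = (r1 \<otimes> r1 \<oplus> r2 \<otimes> r2) \<oplus> (p1 \<otimes> p1 \<oplus> p2 \<otimes> p2)
      \<ominus> ((r1 \<ominus> p1) \<otimes> (r1 \<ominus> p1) \<oplus> (r2 \<ominus> p2) \<otimes> (r2 \<ominus> p2))"
    using C by algebra
  also have "\<dots> = \<one>" unfolding p r rp by algebra
  finally have twice_a: "\<two> \<otimes> ?a = \<one>" .
  have "(\<one> \<ominus> a) \<otimes> (\<one> \<ominus> a) \<oplus> b \<otimes> b = (a \<otimes> a \<oplus> b \<otimes> b) \<oplus> \<one> \<ominus> \<two> \<otimes> a"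
    if "a \<in> carrier R" "b \<in> carrier R" for a b
    using that by algebra
  from this[OF aC bC] have "(\<one> \<ominus> ?a) \<otimes> (\<one> \<ominus> ?a) \<oplus> ?b \<otimes> ?b = \<one> \<oplus> \<one> \<ominus> \<one>"
    unfolding ab twice_a .
  also have "\<dots> = \<one>" by algebra
  finally show "(\<one> \<ominus> ?a) \<otimes> (\<one> \<ominus> ?a) \<oplus> ?b \<otimes> ?b = \<one>" .
qed

section \<open>The unit-distance graph\<close>

lemma sq_dist_eq:
  assumes "x \<in> plane R" "y \<in> plane R"
  shows "sq_dist R x y =
    (fst x \<ominus> fst y) \<otimes> (fst x \<ominus> fst y) \<oplus> (snd x \<ominus> snd y) \<otimes> (snd x \<ominus> snd y)"
  using assms by (auto simp: sq_dist_def plane_def numeral_2_eq_2)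

lemma sq_dist_commute:
  assumes "x \<in> plane R" "y \<in> plane R"
  shows "sq_dist R x y = sq_dist R y x"
proof -
  have "(a \<ominus> c) \<otimes> (a \<ominus> c) \<oplus> (b \<ominus> d) \<otimes> (b \<ominus> d) = (c \<ominus> a) \<otimes> (c \<ominus> a) \<oplus> (d \<ominus> b) \<otimes> (d \<ominus> b)"
    if "a \<in> carrier R" "b \<in> carrier R" "c \<in> carrier R" "d \<in> carrier R" for a b c d
    using that by algebra
  then show ?thesis
    using assms by (auto simp: sq_dist_eq plane_def)
qed

lemma sq_dist_self: "x \<in> plane R \<Longrightarrow> sq_dist R x x = \<zero>"
  by (auto simp: sq_dist_eq plane_def a_minus_def r_neg)

lemma card_common_unit_neighbours_le:
  assumes two: "\<two> \<noteq> \<zero>" and x: "x \<in> plane R" and y: "y \<in> plane R" and "x \<noteq> y"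
  shows "card {w \<in> plane R. sq_dist R x w = \<one> \<and> sq_dist R y w = \<one>} \<le> 2"
proof (cases "{w \<in> plane R. sq_dist R x w = \<one> \<and> sq_dist R y w = \<one>} = {}")
  case True
  then show ?thesis by (subst True) simp
next
  case False
  then obtain u where u: "u \<in> plane R" "sq_dist R x u = \<one>" "sq_dist R y u = \<one>" by blast
  obtain x1 x2 y1 y2 u1 u2 where [simp]: "x = (x1, x2)" "y = (y1, y2)" "u = (u1, u2)"
    by (metis surj_pair)
  have C: "x1 \<in> carrier R" "x2 \<in> carrier R" "y1 \<in> carrier R" "y2 \<in> carrier R"
    "u1 \<in> carrier R" "u2 \<in> carrier R"
    using x y u by (simp_all add: plane_def)
  have cancel: "c \<ominus> (c \<ominus> a) = a" if "a \<in> carrier R" "c \<in> carrier R" for a c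
    using that by algebra
  \<comment> \<open>The second point is \<open>x + y - u\<close>, written in the form in which \<open>two_circles\<close> yields it.\<close>
  have "{w \<in> plane R. sq_dist R x w = \<one> \<and> sq_dist R y w = \<one>}
      \<subseteq> {u, (x1 \<ominus> ((x1 \<ominus> y1) \<ominus> (x1 \<ominus> u1)), x2 \<ominus> ((x2 \<ominus> y2) \<ominus> (x2 \<ominus> u2)))}"
  proof
    fix w assume w: "w \<in> {w \<in> plane R. sq_dist R x w = \<one> \<and> sq_dist R y w = \<one>}"
    obtain w1 w2 where [simp]: "w = (w1, w2)" by fastforce
    have W: "w1 \<in> carrier R" "w2 \<in> carrier R" using w by (simp_all add: plane_def)
    have diff: "(x1 \<ominus> a) \<ominus> (x1 \<ominus> y1) = y1 \<ominus> a" "(x2 \<ominus> a) \<ominus> (x2 \<ominus> y2) = y2 \<ominus> a"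
      if "a \<in> carrier R" for a
      using that C by algebra+
    have "x1 \<ominus> w1 = x1 \<ominus> u1 \<and> x2 \<ominus> w2 = x2 \<ominus> u2 \<or>
        x1 \<ominus> w1 = (x1 \<ominus> y1) \<ominus> (x1 \<ominus> u1) \<and> x2 \<ominus> w2 = (x2 \<ominus> y2) \<ominus> (x2 \<ominus> u2)"
    proof (rule two_circles[OF two])
      show "x1 \<ominus> y1 \<noteq> \<zero> \<or> x2 \<ominus> y2 \<noteq> \<zero>"
        using \<open>x \<noteq> y\<close> C by (auto simp: r_right_minus_eq)
    qed (use u w x y C W in \<open>auto simp: diff sq_dist_eq\<close>)
    then show "w \<in> {u, (x1 \<ominus> ((x1 \<ominus> y1) \<ominus> (x1 \<ominus> u1)), x2 \<ominus> ((x2 \<ominus> y2) \<ominus> (x2 \<ominus> u2)))}"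
      using cancel C W by (metis \<open>u = (u1, u2)\<close> \<open>w = (w1, w2)\<close> insert_iff)
  qed
  then show ?thesis
    by (rule order.trans[OF card_mono[rotated]]) (auto simp: card_insert_if)
qed

text \<open>
  Once a unit equilateral triangle exists, every unit segment is a side of one: rotate \<open>y - x\<close> about
  \<open>x\<close> by the rotation \<open>s + t i\<close> that the given triangle provides. Both \<open>s + t i\<close> and
  \<open>1 - (s + t i)\<close> have norm \<open>1\<close>, so the two new sides are unit segments.
\<close>
lemma third_vertex:
  assumes "\<exists>T. unit_equilateral_triangle R T"
    and x: "x \<in> plane R" and y: "y \<in> plane R" and xy: "sq_dist R x y = \<one>"
  obtains z where "z \<in> plane R" "sq_dist R x z = \<one>" "sq_dist R y z = \<one>"
proof -
  obtain a b c where abc: "a \<in> plane R" "b \<in> plane R" "c \<in> plane R"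
    and d: "sq_dist R a b = \<one>" "sq_dist R b c = \<one>" "sq_dist R a c = \<one>"
    using assms(1) by (auto simp: unit_equilateral_triangle_def)
  obtain a1 a2 b1 b2 c1 c2 where [simp]: "a = (a1, a2)" "b = (b1, b2)" "c = (c1, c2)"
    by (metis surj_pair)
  have C: "a1 \<in> carrier R" "a2 \<in> carrier R" "b1 \<in> carrier R" "b2 \<in> carrier R"
    "c1 \<in> carrier R" "c2 \<in> carrier R"
    using abc by (simp_all add: plane_def)
  have "(a1 \<ominus> c1) \<ominus> (a1 \<ominus> b1) = b1 \<ominus> c1" "(a2 \<ominus> c2) \<ominus> (a2 \<ominus> b2) = b2 \<ominus> c2"
    using C by algebra+
  then obtain s t where st: "s \<in> carrier R" "t \<in> carrier R" "s \<otimes> s \<oplus> t \<otimes> t = \<one>"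
    "(\<one> \<ominus> s) \<otimes> (\<one> \<ominus> s) \<oplus> t \<otimes> t = \<one>"
    using rotation_by_sixty_degrees[of "a1 \<ominus> b1" "a2 \<ominus> b2" "a1 \<ominus> c1" "a2 \<ominus> c2"] C abc d
    by (auto simp: sq_dist_eq)
  obtain x1 x2 y1 y2 where [simp]: "x = (x1, x2)" "y = (y1, y2)" by (metis surj_pair)
  have XY: "x1 \<in> carrier R" "x2 \<in> carrier R" "y1 \<in> carrier R" "y2 \<in> carrier R"
    using x y by (simp_all add: plane_def)
  define e1 where "e1 = x1 \<ominus> y1"
  define e2 where "e2 = x2 \<ominus> y2"
  have E: "e1 \<in> carrier R" "e2 \<in> carrier R" using XY by (simp_all add: e1_def e2_def)
  have e: "e1 \<otimes> e1 \<oplus> e2 \<otimes> e2 = \<one>"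
    using xy x y by (simp add: sq_dist_eq e1_def e2_def)
  define z where "z = (x1 \<ominus> (s \<otimes> e1 \<ominus> t \<otimes> e2), x2 \<ominus> (s \<otimes> e2 \<oplus> t \<otimes> e1))"
  have z: "z \<in> plane R" using XY E st by (simp add: z_def plane_def)
  have cancel: "p \<ominus> (p \<ominus> r) = r" if "p \<in> carrier R" "r \<in> carrier R" for p r
    using that by algebra
  have "sq_dist R x z = (s \<otimes> s \<oplus> t \<otimes> t) \<otimes> (e1 \<otimes> e1 \<oplus> e2 \<otimes> e2)"
    using brahmagupta[of s t e1 e2] st E XY x z by (simp add: sq_dist_eq z_def cancel)
  then have xz: "sq_dist R x z = \<one>" by (simp add: st e)
  have "y1 \<ominus> (x1 \<ominus> (s \<otimes> e1 \<ominus> t \<otimes> e2)) = \<ominus> ((\<one> \<ominus> s) \<otimes> e1 \<ominus> (\<ominus> t) \<otimes> e2)"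
    "y2 \<ominus> (x2 \<ominus> (s \<otimes> e2 \<oplus> t \<otimes> e1)) = \<ominus> ((\<one> \<ominus> s) \<otimes> e2 \<oplus> (\<ominus> t) \<otimes> e1)"
    unfolding e1_def e2_def using XY st by algebra+
  then have "sq_dist R y z =
      ((\<one> \<ominus> s) \<otimes> (\<one> \<ominus> s) \<oplus> (\<ominus> t) \<otimes> (\<ominus> t)) \<otimes> (e1 \<otimes> e1 \<oplus> e2 \<otimes> e2)"
    using brahmagupta[of "\<one> \<ominus> s" "\<ominus> t" e1 e2] st E XY y z
    by (simp add: sq_dist_eq z_def l_minus r_minus)
  then have yz: "sq_dist R y z = \<one>" using st by (simp add: e l_minus r_minus)
  show thesis using that z xz yz by blast
qed

lemma card_square_roots_le: "card {x \<in> carrier R. x \<otimes> x = c} \<le> 2"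
proof (cases "{x \<in> carrier R. x \<otimes> x = c} = {}")
  case True
  then show ?thesis by (subst True) simp
next
  case False
  then obtain r where r: "r \<in> carrier R" "r \<otimes> r = c" by blast
  have "x = r \<or> x = \<ominus> r" if x: "x \<in> carrier R" "x \<otimes> x = c" for x
  proof -
    have "(x \<ominus> r) \<otimes> (x \<oplus> r) = x \<otimes> x \<ominus> r \<otimes> r" using x(1) r(1) by algebra
    then have "x \<ominus> r = \<zero> \<or> x \<oplus> r = \<zero>"
      using x r by (metis integral r_right_minus_eq minus_closed a_closed m_closed)
    then show ?thesis
      using x r by (metis r_right_minus_eq minus_equality)
  qed
  then have "{x \<in> carrier R. x \<otimes> x = c} \<subseteq> {r, \<ominus> r}" by blast
  then show ?thesis
    by (rule order.trans[OF card_mono[rotated]]) (auto simp: card_insert_if)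
qed

text \<open>The points \<open>(a, b)\<close> of the plane with \<open>a\<^sup>2 + b\<^sup>2 = 1\<close>.\<close>
definition unit_circle :: "('a \<times> 'a) set" where
  "unit_circle = {u \<in> plane R. fst u \<otimes> fst u \<oplus> snd u \<otimes> snd u = \<one>}"

lemma card_unit_neighbours_eq:
  assumes x: "x \<in> plane R"
  shows "card {y \<in> plane R. sq_dist R x y = \<one>} = card unit_circle"
proof -
  have cancel: "p \<ominus> (p \<ominus> r) = r" if "p \<in> carrier R" "r \<in> carrier R" for p r
    using that by algebra
  let ?f = "\<lambda>u. (fst x \<ominus> fst u, snd x \<ominus> snd u)"
  have "bij_betw ?f {y \<in> plane R. sq_dist R x y = \<one>} unit_circle"
    by (rule bij_betw_byWitness[where f' = ?f])
      (use x in \<open>auto simp: unit_circle_def sq_dist_eq plane_def cancel\<close>)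
  then show ?thesis by (rule bij_betw_same_card)
qed

lemma card_unit_circle_le:
  assumes "finite (carrier R)"
  shows "card unit_circle \<le> 2 * card (carrier R)"
proof -
  have "unit_circle \<subseteq> (SIGMA a:carrier R. {b \<in> carrier R. b \<otimes> b = \<one> \<ominus> a \<otimes> a})"
  proof -
    have "b \<otimes> b = (a \<otimes> a \<oplus> b \<otimes> b) \<ominus> a \<otimes> a" if "a \<in> carrier R" "b \<in> carrier R" for a b
      using that by algebra
    then show ?thesis unfolding unit_circle_def plane_def by fastforce
  qed
  then have "card unit_circle \<le> card (SIGMA a:carrier R. {b \<in> carrier R. b \<otimes> b = \<one> \<ominus> a \<otimes> a})"
    using assms by (intro card_mono) auto
  also have "\<dots> = (\<Sum>a\<in>carrier R. card {b \<in> carrier R. b \<otimes> b = \<one> \<ominus> a \<otimes> a})"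
    using assms by simp
  also have "\<dots> \<le> (\<Sum>a\<in>carrier R. 2)"
    by (intro sum_mono card_square_roots_le)
  finally show ?thesis by simp
qed

text \<open>
  The inverse of the stereographic projection from \<open>(1, 0)\<close> sends \<open>t\<close> to \<open>(1 - 2 w, 2 w t)\<close> with
  \<open>w = 1 / (t\<^sup>2 + 1)\<close>. It is injective and defined unless \<open>t\<^sup>2 = -1\<close>, which excludes at most two
  values of \<open>t\<close>.
\<close>
lemma card_unit_circle_ge:
  assumes fin: "finite (carrier R)" and two: "\<two> \<noteq> \<zero>"
  shows "card (carrier R) \<le> card unit_circle + 2"
proof -
  define T where "T = {t \<in> carrier R. t \<otimes> t \<oplus> \<one> \<noteq> \<zero>}"
  define w where "w t = inv (t \<otimes> t \<oplus> \<one>)" for t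
  define f where "f t = (\<one> \<ominus> \<two> \<otimes> w t, \<two> \<otimes> w t \<otimes> t)" for t
  have tC: "t \<in> carrier R" if "t \<in> T" for t using that by (simp add: T_def)
  have wC: "w t \<in> carrier R" "w t \<otimes> (t \<otimes> t \<oplus> \<one>) = \<one>" if "t \<in> T" for t
  proof -
    have "t \<otimes> t \<oplus> \<one> \<in> Units R" using that by (simp add: T_def field_Units)
    then show "w t \<in> carrier R" "w t \<otimes> (t \<otimes> t \<oplus> \<one>) = \<one>"
      unfolding w_def by (auto simp: Units_l_inv)
  qed
  have w_nonzero: "w t \<noteq> \<zero>" if "t \<in> T" for t
    using wC[OF that] tC[OF that] by force
  have "f ` T \<subseteq> unit_circle"
  proof (rule image_subsetI)
    fix t assume t: "t \<in> T"
    define h where "h = \<two> \<otimes> w t"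
    have hC: "h \<in> carrier R" using wC[OF t] by (simp add: h_def)
    have h: "h \<otimes> (t \<otimes> t \<oplus> \<one>) = \<two>"
      using wC[OF t] tC[OF t] by (simp add: h_def m_assoc)
    have "(\<one> \<ominus> h) \<otimes> (\<one> \<ominus> h) \<oplus> (h \<otimes> t) \<otimes> (h \<otimes> t) =
        \<one> \<ominus> \<two> \<otimes> h \<oplus> h \<otimes> (h \<otimes> (t \<otimes> t \<oplus> \<one>))"
      using hC tC[OF t] by algebra
    also have "\<dots> = \<one>" unfolding h using hC by algebra
    finally show "f t \<in> unit_circle"
      using hC tC[OF t] by (simp add: f_def unit_circle_def plane_def flip: h_def)
  qed
  moreover have "inj_on f T"
  proof (rule inj_onI)
    fix s t assume st: "s \<in> T" "t \<in> T" and eq: "f s = f t"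
    have "\<two> \<otimes> v = \<one> \<ominus> (\<one> \<ominus> \<two> \<otimes> v)" if "v \<in> carrier R" for v
      using that by algebra
    from this[OF wC(1)[OF st(1)]] this[OF wC(1)[OF st(2)]]
    have "\<two> \<otimes> w s = \<two> \<otimes> w t" using eq by (simp add: f_def)
    moreover have "\<two> \<otimes> w s \<otimes> s = \<two> \<otimes> w t \<otimes> t" using eq by (simp add: f_def)
    ultimately have "\<two> \<otimes> w t \<otimes> s = \<two> \<otimes> w t \<otimes> t" by simp
    moreover have "\<two> \<otimes> w t \<noteq> \<zero>"
      using two w_nonzero[OF st(2)] wC(1)[OF st(2)] by (simp add: integral_iff)
    ultimately show "s = t"
      using m_lcancel[of "\<two> \<otimes> w t" s t] wC(1)[OF st(2)] tC st by simp
  qed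
  ultimately have "card T \<le> card unit_circle"
    using fin by (intro card_inj_on_le[of f]) (auto simp: unit_circle_def plane_def)
  moreover have "carrier R - T = {t \<in> carrier R. t \<otimes> t = \<ominus> \<one>}"
  proof -
    have "t \<otimes> t \<oplus> \<one> = \<zero> \<longleftrightarrow> t \<otimes> t = \<ominus> \<one>" if "t \<in> carrier R" for t
      using that by (metis minus_equality l_neg m_closed one_closed)
    then show ?thesis by (auto simp: T_def)
  qed
  then have "card (carrier R - T) \<le> 2" using card_square_roots_le by simp
  moreover have "card (carrier R) = card T + card (carrier R - T)"
    using fin card_Int_Diff[of "carrier R" T] by (simp add: T_def Int_absorb1 flip: Collect_conj_eq)
  ultimately show ?thesis by simp
qed

section \<open>Rainbow triangles\<close>

lemma rainbow_triangle_exists: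
  assumes fin: "finite (carrier R)" and odd: "odd (order R)"
    and tri: "\<exists>T. unit_equilateral_triangle R T"
    and P: "partition_on (plane R) P"
    and K: "\<And>A. A \<in> P \<Longrightarrow> real (card A) \<le> K"
    and large: "5 * sqrt (2 * real (order R) + 2 * K) < real (order R) - 2"
  shows "\<exists>T. unit_equilateral_triangle R T \<and> rainbow_triangle P T"
proof (rule ccontr)
  assume no_rainbow: "\<not> ?thesis"
  note two = two_nonzero_of_odd_order[OF odd]
  have finV: "finite (plane R)" using fin by (simp add: plane_def)
  interpret G: small_codegree_graph "plane R" "\<lambda>x y. sq_dist R x y = \<one>" "2 * real (order R)"
  proof
    show "real (card {w \<in> plane R. sq_dist R x w = \<one>}) \<le> 2 * real (order R)"
      if "x \<in> plane R" for x
      using card_unit_circle_le[OF fin] card_unit_neighbours_eq[OF that]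
      by (simp add: order_def)
  qed (use finV sq_dist_self two card_common_unit_neighbours_le in
      \<open>auto simp: sq_dist_commute\<close>)
  have V: "card (plane R) = order R * order R" "card (plane R) > 0"
    using fin by (auto simp: plane_def order_def card_cartesian_product card_gt_0_iff)
  have "G.edges = (SIGMA x:plane R. {y \<in> plane R. sq_dist R x y = \<one>})"
    by (auto simp: G.edges_def)
  then have edges: "card G.edges = card (plane R) * card unit_circle"
    using finV card_unit_neighbours_eq by simp
  have "card G.edges \<le> 5 * card (G.mono_edges P)"
  proof (rule G.card_edges_le_mono_edges)
    show "\<exists>z\<in>plane R. sq_dist R x z = \<one> \<and> sq_dist R y z = \<one>" if "(x, y) \<in> G.edges" for x y
      using that third_vertex[OF tri, of x y] unfolding G.edges_def by blast
    show "\<exists>A\<in>P. x \<in> A \<and> y \<in> A \<or> x \<in> A \<and> z \<in> A \<or> y \<in> A \<and> z \<in> A"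
      if xyz: "x \<in> plane R" "y \<in> plane R" "z \<in> plane R"
        and d: "sq_dist R x y = \<one>" "sq_dist R x z = \<one>" "sq_dist R y z = \<one>" for x y z
    proof -
      obtain A B C where ABC: "A \<in> P" "B \<in> P" "C \<in> P" "x \<in> A" "y \<in> B" "z \<in> C"
        using xyz partition_onD1[OF P] by blast
      have "unit_equilateral_triangle R {x, y, z}"
        using xyz d unfolding unit_equilateral_triangle_def by blast
      then have "\<not> rainbow_triangle P {x, y, z}" using no_rainbow by blast
      then have "\<not> distinct [A, B, C]"
        using ABC unfolding rainbow_triangle_def by blast
      then show ?thesis using ABC by auto
    qed
  qed
  then have "real (card (plane R)) * real (card unit_circle) \<le> 5 * real (card (G.mono_edges P))"
    unfolding edges by (metis of_nat_le_iff of_nat_mult of_nat_numeral)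
  also have "\<dots> \<le> real (card (plane R)) * (5 * sqrt (2 * real (order R) + 2 * K))"
    using G.card_mono_edges_le[OF P K] by simp
  finally have "real (card unit_circle) \<le> 5 * sqrt (2 * real (order R) + 2 * K)"
    using V(2) by (simp add: mult_le_cancel_left_pos)
  moreover have "real (order R) - 2 \<le> real (card unit_circle)"
    using card_unit_circle_ge[OF fin two] by (simp add: order_def)
  ultimately show False using large by linarith
qed

end

lemma sqrt_bound_of_large:
  fixes q :: real
  assumes "q \<ge> 100"
  shows "5 * sqrt (2 * q + 2 * (1 / 200 * q\<^sup>2)) < q - 2"
proof -
  have "100 * q \<le> q\<^sup>2" using assms by (simp add: power2_eq_square mult_right_mono)
  then have "2 * q + 2 * (1 / 200 * q\<^sup>2) < ((q - 2) / 5)\<^sup>2"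
    using assms by (simp add: power_divide power2_diff field_simps)
  then have "sqrt (2 * q + 2 * (1 / 200 * q\<^sup>2)) < (q - 2) / 5"
    using assms by (intro real_less_lsqrt) auto
  then show ?thesis by simp
qed

theorem theorem1:
  fixes q :: "nat \<Rightarrow> nat"
    and F :: "nat \<Rightarrow> ('a, 'm) ring_scheme"
    and P :: "nat \<Rightarrow> ('a \<times> 'a) set set"
  assumes prime_power: "\<And>j. j \<ge> 1 \<Longrightarrow> primepow (q j)"
    and odd_q: "\<And>j. j \<ge> 1 \<Longrightarrow> odd (q j)"
    and q_tendsto: "filterlim q at_top sequentially"
    and fields: "\<And>j. j \<ge> 1 \<Longrightarrow> field (F j)"
    and order_F: "\<And>j. j \<ge> 1 \<Longrightarrow> order (F j) = q j"
    and coloring: "\<And>j. j \<ge> 1 \<Longrightarrow> partition_on (plane (F j)) (P j)"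
    and small_classes:
      "\<And>c::real. c > 0 \<Longrightarrow>
         \<exists>j0\<ge>1. \<forall>j\<ge>j0. \<not> (\<exists>A\<in>P j. real (card A) > c * (real (q j))\<^sup>2)"
  shows "\<exists>J\<ge>1. \<forall>j\<ge>J.
           (\<exists>T. unit_equilateral_triangle (F j) T) \<longrightarrow>
           (\<exists>T. unit_equilateral_triangle (F j) T \<and> rainbow_triangle (P j) T)"
proof -
  obtain j0 where j0: "j0 \<ge> 1"
    "\<And>j A. j \<ge> j0 \<Longrightarrow> A \<in> P j \<Longrightarrow> real (card A) \<le> 1 / 200 * (real (q j))\<^sup>2"
    using small_classes[of "1 / 200"] by (auto simp: not_less)
  obtain j1 where j1: "\<And>j. j \<ge> j1 \<Longrightarrow> q j \<ge> 100"
    using q_tendsto by (auto simp: filterlim_at_top eventually_sequentially)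
  show ?thesis
  proof (intro exI[of _ "max j0 j1"] conjI allI impI)
    show "max j0 j1 \<ge> 1" using j0(1) by simp
  next
    fix j assume j: "max j0 j1 \<le> j" and tri: "\<exists>T. unit_equilateral_triangle (F j) T"
    then have "j \<ge> 1" "j \<ge> j0" "q j \<ge> 100" using j0(1) j1 by auto
    then interpret field "F j" using fields by blast
    have ord: "order (F j) = q j" using order_F \<open>j \<ge> 1\<close> .
    show "\<exists>T. unit_equilateral_triangle (F j) T \<and> rainbow_triangle (P j) T"
    proof (rule rainbow_triangle_exists[OF _ _ tri coloring[OF \<open>j \<ge> 1\<close>] j0(2)[OF \<open>j \<ge> j0\<close>]])
      show "finite (carrier (F j))"
        using ord \<open>q j \<ge> 100\<close> by (auto simp: order_def intro: card_ge_0_finite)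
      show "odd (order (F j))" using ord odd_q \<open>j \<ge> 1\<close> by simp
      show "5 * sqrt (2 * real (order (F j)) + 2 * (1 / 200 * (real (q j))\<^sup>2)) < real (order (F j)) - 2"
        unfolding ord using sqrt_bound_of_large[of "real (q j)"] \<open>q j \<ge> 100\<close> by simp
    qed
  qed
qed

end
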